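(* Assume that there are constants $c,r_0>0$ such that $\kappa(r_0)\le -c$ and $\delta_0:=\sup_{0<r\le r_0}\kappa(r)<+\infty$. Then there exists a constant $c'>0$ such that $\kappa(r)\le -c'r$ for all $r>0$ large enough.
   Context: Let $\sigma\in\mathbb{R}^{d\times d}$ be a non-degenerate (invertible) constant matrix and $b:\mathbb{R}^d\to\mathbb{R}^d$ a Borel measurable vector field (the coefficients of the stochastic differential equation $dX_t=\sigma\,dB_t+b(X_t)\,dt$). For $r>0$ define $$\kappa(r):=\sup\bigg\{\frac{\langle\sigma^{-1}(x-y),\sigma^{-1}(b(x)-b(y))\rangle}{2|\sigma^{-1}(x-y)|}: x,y\in\mathbb{R}^d,\ |\sigma^{-1}(x-y)|=r\bigg\}.$$ Here $|\cdot|$ is the Euclidean norm and $\langle\cdot,\cdot\rangle$ the Euclidean inner product. *)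

theory Defs
  imports "HOL-Analysis.Analysis"
begin

text \<open>
  The supremum is taken in the extended reals, since it may be \<open>+\<infinity>\<close> for an arbitrary vector
  field \<open>b\<close>. Only radii \<open>r > 0\<close> are meaningful: for \<open>r = 0\<close> the quotient is \<open>0 / 0 = 0\<close>.
\<close>

definition kappa :: "real ^ 'd ^ 'd \<Rightarrow> (real ^ 'd \<Rightarrow> real ^ 'd) \<Rightarrow> real \<Rightarrow> ereal" where
  "kappa \<sigma> b r =
     Sup {ereal (((matrix_inv \<sigma> *v (x - y)) \<bullet> (matrix_inv \<sigma> *v (b x - b y)))
                   / (2 * norm (matrix_inv \<sigma> *v (x - y)))) | x y.
            norm (matrix_inv \<sigma> *v (x - y)) = r}"

end

theory Submission
  imports Defs
begin

text \<open>
  The function \<open>kappa \<sigma> b\<close> is subadditive on the positive reals: a segment from \<open>y\<close> to \<open>x\<close> of length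
  \<open>r + s\<close> (in the norm \<open>\<bar>\<sigma>\<^sup>-\<^sup>1 \<cdot>\<bar>\<close>) can be cut into pieces of lengths \<open>r\<close> and \<open>s\<close>.  All three
  segments have the same unit direction \<open>u\<close>, and the quotient defining \<open>kappa\<close> is half the component
  along \<open>u\<close> of the increment of \<open>\<sigma>\<^sup>-\<^sup>1 b\<close> over the segment, so the quotient of the long segment is the
  sum of those of the two pieces.

  Write a radius as \<open>r = n * r0 + s\<close> with \<open>0 < s \<le> r0\<close>.  By subadditivity each of the \<open>n\<close> steps of
  length \<open>r0\<close> contributes at most \<open>- c\<close>, and the remaining step contributes at most a constant \<open>D\<close>
  that bounds \<open>kappa\<close> on \<open>(0, r0]\<close>.  Since \<open>n \<ge> r / r0 - 1\<close>, this gives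
  \<open>kappa \<sigma> b r \<le> D + c - (c / r0) * r\<close>, and half of the slope \<open>c / r0\<close> absorbs the constant \<open>D + c\<close>
  for large \<open>r\<close>.
\<close>

text \<open>
  The cut point \<open>z\<close> lies at distance \<open>s\<close> from \<open>y\<close>, so the suprema on the right dominate the quotients
  of the pieces from \<open>z\<close> to \<open>x\<close> and from \<open>y\<close> to \<open>z\<close>; addition of extended reals is monotone even when a
  supremum is infinite.
\<close>

lemma kappa_subadditive:
  fixes \<sigma> :: "real ^ 'd ^ 'd"
  assumes "r > 0" and "s > 0"
  shows "kappa \<sigma> b (r + s) \<le> kappa \<sigma> b r + kappa \<sigma> b s"
  unfolding kappa_def[of \<sigma> b "r + s"]
proof (rule Sup_least, safe)
  fix x y :: "real ^ 'd"
  define A where "A = matrix_inv \<sigma>"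
  define q where
    "q x y = ((A *v (x - y)) \<bullet> (A *v (b x - b y))) / (2 * norm (A *v (x - y)))" for x y
  assume "norm (matrix_inv \<sigma> *v (x - y)) = r + s"
  then have dist: "norm (A *v (x - y)) = r + s"
    by (simp add: A_def)
  have q_le: "ereal (q x' y') \<le> kappa \<sigma> b t" if "norm (A *v (x' - y')) = t" for x' y' t
    unfolding kappa_def q_def A_def by (rule Sup_upper) (use that in \<open>auto simp: A_def\<close>)
  define u where "u = (1 / (r + s)) *\<^sub>R (A *v (x - y))"
  have norm_u: "norm u = 1"
    using dist assms by (simp add: u_def)
  \<comment> \<open>On a segment of direction \<open>u\<close> the length cancels from the quotient.\<close>
  have q_direction: "q x' y' = (u \<bullet> (A *v (b x' - b y'))) / 2"
    if "A *v (x' - y') = t *\<^sub>R u" "t > 0" for x' y' t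
    using that norm_u by (simp add: q_def)
  define z where "z = y + (s / (r + s)) *\<^sub>R (x - y)"
  have long: "A *v (x - y) = (r + s) *\<^sub>R u"
    using assms by (simp add: u_def)
  have "z - y = (s / (r + s)) *\<^sub>R (x - y)"
    by (simp add: z_def)
  then have near: "A *v (z - y) = s *\<^sub>R u"
    by (simp add: u_def matrix_vector_mult_scaleR)
  have "A *v (x - z) = A *v (x - y) - A *v (z - y)"
    by (simp add: matrix_vector_mult_diff_distrib)
  then have far: "A *v (x - z) = r *\<^sub>R u"
    using long near by (simp add: scaleR_add_left)
  have "q x y = q x z + q z y"
    using q_direction[OF long] q_direction[OF far] q_direction[OF near] assms
    by (simp add: matrix_vector_mult_diff_distrib inner_diff_right field_simps)
  then have "ereal (q x y) = ereal (q x z) + ereal (q z y)"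
    by simp
  also have "\<dots> \<le> kappa \<sigma> b r + kappa \<sigma> b s"
    using far near norm_u assms by (intro add_mono q_le) simp_all
  finally show "ereal ((matrix_inv \<sigma> *v (x - y)) \<bullet> (matrix_inv \<sigma> *v (b x - b y))
      / (2 * norm (matrix_inv \<sigma> *v (x - y)))) \<le> kappa \<sigma> b r + kappa \<sigma> b s"
    by (simp add: q_def A_def)
qed

lemma kappa_multiple_step:
  fixes \<sigma> :: "real ^ 'd ^ 'd"
  assumes "r0 > 0" and "s > 0"
    and step: "kappa \<sigma> b r0 \<le> ereal (- c)" and rest: "kappa \<sigma> b s \<le> ereal D"
  shows "kappa \<sigma> b (real n * r0 + s) \<le> ereal (D - real n * c)"
proof (induction n)
  case 0
  then show ?case using rest by simp
next
  case (Suc n)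
  have "kappa \<sigma> b (real (Suc n) * r0 + s) = kappa \<sigma> b (r0 + (real n * r0 + s))"
    by (simp add: algebra_simps)
  also have "\<dots> \<le> kappa \<sigma> b r0 + kappa \<sigma> b (real n * r0 + s)"
    using assms by (intro kappa_subadditive add_nonneg_pos) simp_all
  also have "\<dots> \<le> ereal (- c) + ereal (D - real n * c)"
    by (intro add_mono step Suc.IH)
  finally show ?case by (simp add: algebra_simps)
qed

lemma division_with_positive_remainder:
  fixes r r0 :: real
  assumes "r0 > 0" and "r > 0"
  obtains n :: nat and s where "r = real n * r0 + s" "0 < s" "s \<le> r0"
proof -
  \<comment> \<open>Rounding up and subtracting one, instead of rounding down, keeps the remainder nonzero when
    \<open>r\<close> is a multiple of \<open>r0\<close>.\<close>
  define n where "n = nat (\<lceil>r / r0\<rceil> - 1)"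
  have "\<lceil>r / r0\<rceil> \<ge> 1"
    using assms by (simp add: less_ceiling_iff)
  then have "real n = of_int \<lceil>r / r0\<rceil> - 1"
    by (simp add: n_def)
  then have "real n < r / r0" "r / r0 \<le> real n + 1"
    by linarith+
  then have "real n * r0 < r" "r \<le> (real n + 1) * r0"
    using assms by (simp_all add: field_simps)
  then show thesis
    by (intro that[of n "r - real n * r0"]) (simp_all add: algebra_simps)
qed

theorem proposition1p5:
  fixes \<sigma> :: "real ^ 'd ^ 'd"
    and b :: "real ^ 'd \<Rightarrow> real ^ 'd"
    and c r0 :: real
  assumes "invertible \<sigma>"
    and "b \<in> borel_measurable borel"
    and "c > 0" and "r0 > 0"
    and "kappa \<sigma> b r0 \<le> ereal (- c)"
    and "(SUP r\<in>{0<..r0}. kappa \<sigma> b r) < \<infinity>"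
  shows "\<exists>c'>0. eventually (\<lambda>r. kappa \<sigma> b r \<le> ereal (- c' * r)) at_top"
proof -
  obtain D where D: "(SUP r\<in>{0<..r0}. kappa \<sigma> b r) < ereal D"
    using assms(6) less_PInf_Ex_of_nat by auto
  have rest: "kappa \<sigma> b s \<le> ereal D" if "0 < s" "s \<le> r0" for s
    using that D by (intro order.trans[OF SUP_upper less_imp_le[OF D]]) simp
  have linear: "kappa \<sigma> b r \<le> ereal (D + c - c / r0 * r)" if "r > 0" for r
  proof -
    obtain n :: nat and s where r: "r = real n * r0 + s" and s: "0 < s" "s \<le> r0"
      using division_with_positive_remainder[OF \<open>r0 > 0\<close> \<open>r > 0\<close>] .
    have "kappa \<sigma> b r \<le> ereal (D - real n * c)"
      unfolding r using assms s rest by (intro kappa_multiple_step)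
    also have "D - real n * c \<le> D + c - c / r0 * r"
    proof -
      have "c * s \<le> c * r0"
        using s \<open>c > 0\<close> by simp
      then show ?thesis
        using \<open>r0 > 0\<close> by (simp add: r field_simps)
    qed
    finally show ?thesis by simp
  qed
  show ?thesis
  proof (intro exI conjI)
    show "c / (2 * r0) > 0"
      using assms by simp
    have "kappa \<sigma> b r \<le> ereal (- (c / (2 * r0)) * r)"
      if "r \<ge> max 1 (2 * r0 * (D + c) / c)" for r
    proof -
      have "D + c \<le> c / (2 * r0) * r"
        using that assms by (simp add: field_simps)
      moreover have "c / r0 * r = 2 * (c / (2 * r0) * r)"
        by simp
      ultimately have "D + c - c / r0 * r \<le> - (c / (2 * r0)) * r"
        by simp
      then show ?thesis
        using linear[of r] that by (meson ereal_less_eq(3) less_le_trans max.boundedE order.trans zero_less_one)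
    qed
    then show "eventually (\<lambda>r. kappa \<sigma> b r \<le> ereal (- (c / (2 * r0)) * r)) at_top"
      by (rule eventually_at_top_linorderI)
  qed
qed

end
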